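(* Let $z:\mathcal P(I)\to\hat{\mathbb R}$ be a submodular function on a finite set $I$, let $S\subseteq I$ with $z(S)<\infty$, and $T=I\setminus S$. There is a bijection between: (1) preorders $P$ conforming to $z$ and having $S$ as a down-set, and (2) pairs $(P_1,P_2)$ where $P_1$ is a preorder on $S$ conforming to $z|_S$ and $P_2$ is a preorder on $T$ conforming to $z_{/S}$. Given $P$, the associated pair is $P_1=P|_S$ and $P_2=P_{/S}$ (the restrictions of $P$ to $S$ and to $T$). Moreover, if $P$ corresponds to the face $F$ of $\Pi(z)$, $P_1$ to the face $F_S$ of $\Pi(z|_S)$, and $P_2$ to the face $G_T$ of $\Pi(z_{/S})$, then $F=F_S\times G_T$ in $\mathbb RI=\mathbb RS\times\mathbb RT$.
   Context: $\hat{\mathbb R}=\mathbb R\cup\{\infty\}$. A function $z:\mathcal P(I)\to\hat{\mathbb R}$ with $z(\emptyset)=0$, $z(I)<\infty$ is submodular if $z(A\cup B)+z(A\cap B)\le z(A)+z(B)$ for all $A,B\subseteq I$. If $z(S)<\infty$: $z|_S$ is the restriction of $z$ to $\mathcal P(S)$, and $z_{/S}(U)=z(S\cup U)-z(S)$ for $U\subseteq I\setminus S$ (both submodular). For $A\subseteq B\subseteq I$ with finite values, $z_{B/A}=(z|_B)_{/A}$. A function $z'$ on $\mathcal P(C)$ decomposes along $C=C_1\sqcup C_2$ if $z'(E)=z'(E\cap C_1)+z'(E\cap C_2)$ for all $E\subseteq C$. A preorder is a reflexive transitive relation; down-sets contain everything below their elements; convex subsets are $C=B\setminus A$ with $A\subseteq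 B$ down-sets; $C=C_1\sqcup C_2$ is a disconnected union if no element of $C_1$ is comparable to one of $C_2$. $P$ is compatible with $z$ if $z(A)<\infty$ for all down-sets $A$, and for down-sets $A\subseteq B$ with $B\setminus A=C_1\sqcup C_2$ a disconnected union, $z_{B/A}$ decomposes along $C_1\sqcup C_2$; then $z_{B/A}$ depends only on $C=B\setminus A$ and is written $z_C$. $P$ conforms to $z$ if moreover, for convex $C$, a decomposition of $z_C$ along $C=C_1\sqcup C_2$ implies that $C=C_1\sqcup C_2$ is a disconnected union in $P$. For $x\in\mathbb RI$ (real vector space with basis $I$), $x_A=\sum_{i\in A}x_i$. $\Pi(z)=\{x\in\mathbb RI:x_I=z(I),\ x_A\le z(A)\text{ whenever }z(A)<\infty\}$. The face of $\Pi(z)$ corresponding to a conforming preorder $P$ is $\Phi_z(P)=\{x\in\Pi(z):x_A=z(A)\text{ for all down-sets }A\text{ of }P\}$; this gives a bijection between preorders conforming to $z$ and non-empty faces of $\Pi(z)$. *)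

theory Defs
  imports "HOL-Library.Extended_Real" "HOL-Library.FuncSet"
begin

subsection \<open>Extended submodular functions and their minors\<close>

text \<open>
  A function on \<open>Pow I\<close> with values in the reals extended by \<open>\<infinity>\<close> is an
  \<^typ>\<open>ereal\<close>-valued function that avoids \<open>-\<infinity>\<close> on \<open>Pow I\<close>; values outside
  \<open>Pow I\<close> are irrelevant.
\<close>

definition submodular :: "'a set \<Rightarrow> ('a set \<Rightarrow> ereal) \<Rightarrow> bool" where
  "submodular I z \<longleftrightarrow>
     (\<forall>A\<subseteq>I. z A \<noteq> -\<infinity>) \<and> z {} = 0 \<and> z I < \<infinity> \<and>
     (\<forall>A\<subseteq>I. \<forall>B\<subseteq>I. z (A \<union> B) + z (A \<inter> B) \<le> z A + z B)"

definition sm_restrict :: "('a set \<Rightarrow> ereal) \<Rightarrow> 'a set \<Rightarrow> 'a set \<Rightarrow> ereal" where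
  "sm_restrict z S = restrict z (Pow S)"

definition sm_contract :: "'a set \<Rightarrow> ('a set \<Rightarrow> ereal) \<Rightarrow> 'a set \<Rightarrow> 'a set \<Rightarrow> ereal" where
  "sm_contract I z S = restrict (\<lambda>U. z (S \<union> U) - z S) (Pow (I - S))"

definition sm_minor :: "('a set \<Rightarrow> ereal) \<Rightarrow> 'a set \<Rightarrow> 'a set \<Rightarrow> 'a set \<Rightarrow> ereal" where
  "sm_minor z B A = sm_contract B (sm_restrict z B) A"

definition decomposes_along ::
    "('a set \<Rightarrow> ereal) \<Rightarrow> 'a set \<Rightarrow> 'a set \<Rightarrow> 'a set \<Rightarrow> bool" where
  "decomposes_along z' C C1 C2 \<longleftrightarrow>
     C = C1 \<union> C2 \<and> C1 \<inter> C2 = {} \<and>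
     (\<forall>E\<subseteq>C. z' E = z' (E \<inter> C1) + z' (E \<inter> C2))"

subsection \<open>Preorders\<close>

text \<open>Preorders are relations with \<^const>\<open>preorder_on\<close>; \<open>(a, b) \<in> P\<close> means \<open>a \<le> b\<close>.\<close>

definition down_set :: "'a set \<Rightarrow> 'a rel \<Rightarrow> 'a set \<Rightarrow> bool" where
  "down_set I P A \<longleftrightarrow> A \<subseteq> I \<and> (\<forall>b\<in>A. \<forall>a. (a, b) \<in> P \<longrightarrow> a \<in> A)"

definition disconnected_union :: "'a rel \<Rightarrow> 'a set \<Rightarrow> 'a set \<Rightarrow> 'a set \<Rightarrow> bool" where
  "disconnected_union P C C1 C2 \<longleftrightarrow>
     C = C1 \<union> C2 \<and> C1 \<inter> C2 = {} \<and>
     (\<forall>a\<in>C1. \<forall>b\<in>C2. (a, b) \<notin> P \<and> (b, a) \<notin> P)"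

definition compatible :: "'a set \<Rightarrow> ('a set \<Rightarrow> ereal) \<Rightarrow> 'a rel \<Rightarrow> bool" where
  "compatible I z P \<longleftrightarrow>
     preorder_on I P \<and>
     (\<forall>A. down_set I P A \<longrightarrow> z A < \<infinity>) \<and>
     (\<forall>A B C1 C2. down_set I P A \<and> down_set I P B \<and> A \<subseteq> B \<and>
        disconnected_union P (B - A) C1 C2 \<longrightarrow>
        decomposes_along (sm_minor z B A) (B - A) C1 C2)"

text \<open>
  For a compatible preorder, \<open>sm_minor z B A\<close> depends only on the convex set \<open>B - A\<close>
  (lemma \<open>sm_minor_cong_convex\<close> below), so quantifying over \<open>A\<close> and \<open>B\<close> here is the same
  as quantifying over convex sets \<open>C\<close> and using the function \<open>z\<^sub>C\<close>.
\<close>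

definition conforms :: "'a set \<Rightarrow> ('a set \<Rightarrow> ereal) \<Rightarrow> 'a rel \<Rightarrow> bool" where
  "conforms I z P \<longleftrightarrow>
     compatible I z P \<and>
     (\<forall>A B C1 C2. down_set I P A \<and> down_set I P B \<and> A \<subseteq> B \<and>
        decomposes_along (sm_minor z B A) (B - A) C1 C2 \<longrightarrow>
        disconnected_union P (B - A) C1 C2)"

lemma sm_minor_inter:
  assumes sm: "submodular I z" and comp: "compatible I z P"
    and A: "down_set I P A" and B: "down_set I P B" and "A \<subseteq> B"
    and A': "down_set I P A'" and B': "down_set I P B'" and "A' \<subseteq> B'"
    and eq: "B - A = B' - A'" and U: "U \<subseteq> B - A"
  shows "z (A \<union> U) - z A = z ((A \<inter> A') \<union> U) - z (A \<inter> A')"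
proof -
  let ?A0 = "A \<inter> A'"
  let ?D = "A - A'"
  have dA0: "down_set I P ?A0"
    using A A' unfolding down_set_def by blast
  have BI: "B \<subseteq> I" using B unfolding down_set_def by blast
  have disc: "disconnected_union P (B - ?A0) (B - A) ?D"
    unfolding disconnected_union_def
  proof (intro conjI ballI)
    show "B - ?A0 = (B - A) \<union> ?D" using \<open>A \<subseteq> B\<close> by blast
    show "(B - A) \<inter> ?D = {}" by blast
    fix c d assume c: "c \<in> B - A" and d: "d \<in> ?D"
    show "(c, d) \<notin> P" using c d A unfolding down_set_def by blast
    show "(d, c) \<notin> P"
    proof
      assume "(d, c) \<in> P"
      moreover have "c \<in> B'" using c eq by blast
      ultimately have "d \<in> B'" using B' unfolding down_set_def by blast
      with d eq show False by blast
    qed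
  qed
  have dec: "decomposes_along (sm_minor z B ?A0) (B - ?A0) (B - A) ?D"
    using comp dA0 B disc \<open>A \<subseteq> B\<close> unfolding compatible_def by blast
  have val: "sm_minor z B ?A0 E = z (?A0 \<union> E) - z ?A0" if "E \<subseteq> B - ?A0" for E
  proof -
    have "?A0 \<subseteq> B" "?A0 \<union> E \<subseteq> B" using that \<open>A \<subseteq> B\<close> by blast+
    then show ?thesis
      using that by (simp add: sm_minor_def sm_contract_def sm_restrict_def)
  qed
  have UD: "U \<union> ?D \<subseteq> B - ?A0" and UB: "U \<subseteq> B - ?A0" and DB: "?D \<subseteq> B - ?A0"
    using U \<open>A \<subseteq> B\<close> by blast+
  have i1: "(U \<union> ?D) \<inter> (B - A) = U" and i2: "(U \<union> ?D) \<inter> ?D = ?D"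
    using U by blast+
  have "sm_minor z B ?A0 (U \<union> ?D) = sm_minor z B ?A0 U + sm_minor z B ?A0 ?D"
    using dec UD i1 i2 unfolding decomposes_along_def by metis
  moreover have "?A0 \<union> (U \<union> ?D) = A \<union> U" "?A0 \<union> ?D = A" by blast+
  ultimately have e: "z (A \<union> U) - z ?A0 = (z (?A0 \<union> U) - z ?A0) + (z A - z ?A0)"
    using val[OF UD] val[OF UB] val[OF DB] by simp
  have "z A < \<infinity>" "z ?A0 < \<infinity>" using comp A dA0 unfolding compatible_def by blast+
  moreover have "z A \<noteq> -\<infinity>" "z ?A0 \<noteq> -\<infinity>" "z (A \<union> U) \<noteq> -\<infinity>" "z (?A0 \<union> U) \<noteq> -\<infinity>"
    using sm BI U \<open>A \<subseteq> B\<close> unfolding submodular_def by (metis Diff_subset Un_subset_iff le_infI1 order_trans)+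
  ultimately show ?thesis
    using e by (cases "z A"; cases "z ?A0"; cases "z (A \<union> U)"; cases "z (?A0 \<union> U)") auto
qed

lemma sm_minor_cong_convex:
  assumes "submodular I z" and "compatible I z P"
    and "down_set I P A" and "down_set I P B" and "A \<subseteq> B"
    and "down_set I P A'" and "down_set I P B'" and "A' \<subseteq> B'"
    and eq: "B - A = B' - A'"
  shows "sm_minor z B A = sm_minor z B' A'"
proof
  fix U
  show "sm_minor z B A U = sm_minor z B' A' U"
  proof (cases "U \<subseteq> B - A")
    case True
    then have "z (A \<union> U) - z A = z (A' \<union> U) - z A'"
      using sm_minor_inter[OF assms(1-9), of U]
        sm_minor_inter[OF assms(1,2,6,7,8,3,4,5) eq[symmetric], of U] eq
      by (simp add: Int_commute)
    moreover have "A \<union> U \<subseteq> B" "A' \<union> U \<subseteq> B'" using True assms by blast+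
    ultimately show ?thesis
      using True eq assms by (simp add: sm_minor_def sm_contract_def sm_restrict_def)
  next
    case False
    with eq show ?thesis by (simp add: sm_minor_def sm_contract_def)
  qed
qed

subsection \<open>Extended generalized permutohedra\<close>

text \<open>
  The real vector space with basis \<open>I\<close> is realised as the real functions vanishing off \<open>I\<close>.
  When \<open>I\<close> is the disjoint union of \<open>S\<close> and \<open>T\<close>, the identification of the product of the
  vector spaces on \<open>S\<close> and \<open>T\<close> with the one on \<open>I\<close> is then pointwise addition.
\<close>

definition vec_space :: "'a set \<Rightarrow> ('a \<Rightarrow> real) set" where
  "vec_space I = {x. \<forall>i. i \<notin> I \<longrightarrow> x i = 0}"

definition polyhedron_of :: "'a set \<Rightarrow> ('a set \<Rightarrow> ereal) \<Rightarrow> ('a \<Rightarrow> real) set" where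
  "polyhedron_of I z =
     {x \<in> vec_space I. ereal (\<Sum>i\<in>I. x i) = z I \<and>
        (\<forall>A\<subseteq>I. z A < \<infinity> \<longrightarrow> ereal (\<Sum>i\<in>A. x i) \<le> z A)}"

definition face_of_preorder ::
    "'a set \<Rightarrow> ('a set \<Rightarrow> ereal) \<Rightarrow> 'a rel \<Rightarrow> ('a \<Rightarrow> real) set" where
  "face_of_preorder I z P =
     {x \<in> polyhedron_of I z. \<forall>A. down_set I P A \<longrightarrow> ereal (\<Sum>i\<in>A. x i) = z A}"

definition vec_prod :: "('a \<Rightarrow> real) set \<Rightarrow> ('a \<Rightarrow> real) set \<Rightarrow> ('a \<Rightarrow> real) set" where
  "vec_prod F G = (\<lambda>(x, y) i. x i + y i) ` (F \<times> G)"

end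

theory Submission
  imports Defs
begin

text \<open>
  A preorder on a finite set is determined by its family of down-sets, and the families that arise
  are those that contain the empty set and the ground set and are closed under unions and
  intersections (\<open>down_sets_inject\<close>, \<open>down_sets_preorder_of_family\<close>).  The proof moves the whole statement to these families.

  Let \<open>\<F>\<close> be the ring of sets on which \<open>z\<close> is finite.  Submodularity makes a decomposition of a
  minor along \<open>C1 \<squnion> C2\<close> a single numerical equality
  (\<open>decomposes_along_minor_iff\<close>): if the decomposition formula holds for the full set \<open>C1 \<union> C2\<close>, it
  holds for every subset.  On the other side, \<open>C1 \<squnion> C2\<close> is a disconnected union exactly when
  \<open>A \<union> C1\<close> and \<open>A \<union> C2\<close> are down-sets.  Hence \<open>P\<close> conforms to \<open>z\<close> if and only if its family
  \<open>D\<close> of down-sets satisfies (\<open>conforms_iff\<close>): \<open>D \<subseteq> \<F>\<close>, \<open>z\<close> is modular on \<open>D\<close>, and whenever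
  \<open>X \<union> Y\<close> and \<open>X \<inter> Y\<close> are in \<open>D\<close> and \<open>z(X \<union> Y) + z(X \<inter> Y) = z(X) + z(Y)\<close>, then \<open>X\<close> and \<open>Y\<close> are
  in \<open>D\<close>.

  Applied to an arbitrary \<open>X \<in> \<F>\<close> and to \<open>S \<in> D\<close>, this says that \<open>X \<in> D\<close> if and only if
  \<open>X \<inter> S \<in> D\<close>, \<open>X \<union> S \<in> D\<close> and \<open>z(X \<union> S) + z(X \<inter> S) = z(X) + z(S)\<close>.  The members of \<open>D\<close> inside
  \<open>S\<close> are the down-sets of \<open>P|\<^sub>S\<close>, those containing \<open>S\<close> are \<open>S \<union> U\<close> for the down-sets \<open>U\<close> of
  \<open>P\<^bsub>/S\<^esub>\<close>, so the pair determines \<open>P\<close>, and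
  the same formula defines a family \<open>D\<close> from any conforming pair.  To see that this \<open>D\<close> is a
  conforming family, compare \<open>z\<close> with \<open>f(X) = z(X \<inter> S) + z(X \<union> S) - z(S)\<close>.  Always
  \<open>f \<le> z\<close>, with equality on \<open>D\<close>, and \<open>f\<close> is submodular on \<open>\<F>\<close> and modular on the sets whose
  two parts lie in the given families.  Closure, modularity and the converse condition
  come from chains of inequalities between \<open>z\<close> and \<open>f\<close> whose two ends coincide
  (\<open>glue_families_lattice\<close>, \<open>glue_families_factor\<close>).

  The factorization of faces rests on the same comparison.  A point with \<open>x\<^sub>S = z(S)\<close> splits into a
  point over \<open>S\<close> and a point over \<open>T\<close>; conversely, for two such points,
  \<open>x\<^sub>A = x\<^bsub>A \<inter> S\<^esub> + x\<^bsub>A - S\<^esub> \<le> f(A) \<le> z(A)\<close>, with equality throughout when \<open>A\<close> is a down-set.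
\<close>

section \<open>The ring of sets of finite value\<close>

definition finite_valued :: "'a set \<Rightarrow> ('a set \<Rightarrow> ereal) \<Rightarrow> 'a set set" where
  "finite_valued I z = {X. X \<subseteq> I \<and> z X < \<infinity>}"

definition real_value :: "('a set \<Rightarrow> ereal) \<Rightarrow> 'a set \<Rightarrow> real" where
  "real_value z X = real_of_ereal (z X)"

text \<open>
  Restricting to \<^const>\<open>finite_valued\<close> turns every inequality below into real linear
  arithmetic; the infinite values of \<open>z\<close> survive only in the requirement that this family be
  closed under unions and intersections.
\<close>

definition submodular_on :: "'a set set \<Rightarrow> ('a set \<Rightarrow> real) \<Rightarrow> bool" where
  "submodular_on \<F> r \<longleftrightarrow>
     (\<forall>X\<in>\<F>. \<forall>Y\<in>\<F>. X \<union> Y \<in> \<F> \<and> X \<inter> Y \<in> \<F> \<and> r (X \<union> Y) + r (X \<inter> Y) \<le> r X + r Y)"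

lemma submodular_onD:
  assumes "submodular_on \<F> r" "X \<in> \<F>" "Y \<in> \<F>"
  shows "X \<union> Y \<in> \<F>" "X \<inter> Y \<in> \<F>" "r (X \<union> Y) + r (X \<inter> Y) \<le> r X + r Y"
  using assms unfolding submodular_on_def by blast+

lemma ereal_real_value:
  assumes "submodular I z" "X \<in> finite_valued I z"
  shows "z X = ereal (real_value z X)"
  using assms unfolding submodular_def finite_valued_def real_value_def
  by (cases "z X") auto

lemma infinite_value:
  assumes "X \<subseteq> I" "X \<notin> finite_valued I z"
  shows "z X = \<infinity>"
  using assms unfolding finite_valued_def by auto

lemma submodular_on_finite_valued:
  assumes sm: "submodular I z"
  shows "submodular_on (finite_valued I z) (real_value z)"
  unfolding submodular_on_def
proof (intro ballI)
  fix X Y assume X: "X \<in> finite_valued I z" and Y: "Y \<in> finite_valued I z"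
  have sub: "X \<subseteq> I" "Y \<subseteq> I" "X \<union> Y \<subseteq> I" "X \<inter> Y \<subseteq> I"
    using X Y unfolding finite_valued_def by auto
  have le: "z (X \<union> Y) + z (X \<inter> Y) \<le> ereal (real_value z X) + ereal (real_value z Y)"
    using sm sub ereal_real_value[OF sm X] ereal_real_value[OF sm Y] unfolding submodular_def by metis
  have ninf: "z (X \<union> Y) \<noteq> -\<infinity>" "z (X \<inter> Y) \<noteq> -\<infinity>"
    using sm sub unfolding submodular_def by blast+
  have "X \<union> Y \<in> finite_valued I z" "X \<inter> Y \<in> finite_valued I z"
    using le ninf sub unfolding finite_valued_def
    by (cases "z (X \<union> Y)"; cases "z (X \<inter> Y)"; simp)+
  then show "X \<union> Y \<in> finite_valued I z \<and> X \<inter> Y \<in> finite_valued I z \<and>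
      real_value z (X \<union> Y) + real_value z (X \<inter> Y) \<le> real_value z X + real_value z Y"
    using le ereal_real_value[OF sm] by simp
qed

lemma ground_set_finite_valued: "submodular I z \<Longrightarrow> I \<in> finite_valued I z"
  unfolding submodular_def finite_valued_def by simp

section \<open>Conforming preorders through their down-sets\<close>

text \<open>
  The first two clauses express compatibility, the third the converse that conforming adds.  Stating
  them for an
  arbitrary family \<open>\<F>\<close> and function \<open>r\<close> lets restriction and contraction of \<open>z\<close> be treated
  alike.
\<close>

definition conforming_family :: "'a set set \<Rightarrow> ('a set \<Rightarrow> real) \<Rightarrow> 'a set set \<Rightarrow> bool" where
  "conforming_family \<F> r D \<longleftrightarrow> D \<subseteq> \<F> \<and>
     (\<forall>X\<in>D. \<forall>Y\<in>D. r (X \<union> Y) + r (X \<inter> Y) = r X + r Y) \<and>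
     (\<forall>X\<in>\<F>. \<forall>Y\<in>\<F>. X \<union> Y \<in> D \<and> X \<inter> Y \<in> D \<and> r (X \<union> Y) + r (X \<inter> Y) = r X + r Y
        \<longrightarrow> X \<in> D \<and> Y \<in> D)"

lemma conforming_familyD:
  assumes "conforming_family \<F> r D"
  shows "D \<subseteq> \<F>"
    and "X \<in> D \<Longrightarrow> Y \<in> D \<Longrightarrow> r (X \<union> Y) + r (X \<inter> Y) = r X + r Y"
    and "X \<in> \<F> \<Longrightarrow> Y \<in> \<F> \<Longrightarrow> X \<union> Y \<in> D \<Longrightarrow> X \<inter> Y \<in> D \<Longrightarrow>
      r (X \<union> Y) + r (X \<inter> Y) = r X + r Y \<Longrightarrow> X \<in> D \<and> Y \<in> D"
  using assms unfolding conforming_family_def by blast+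

lemma conforming_familyI:
  assumes "D \<subseteq> \<F>"
    and "\<And>X Y. X \<in> D \<Longrightarrow> Y \<in> D \<Longrightarrow> r (X \<union> Y) + r (X \<inter> Y) = r X + r Y"
    and "\<And>X Y. X \<in> \<F> \<Longrightarrow> Y \<in> \<F> \<Longrightarrow> X \<union> Y \<in> D \<Longrightarrow> X \<inter> Y \<in> D \<Longrightarrow>
      r (X \<union> Y) + r (X \<inter> Y) = r X + r Y \<Longrightarrow> X \<in> D \<and> Y \<in> D"
  shows "conforming_family \<F> r D"
  unfolding conforming_family_def
proof (intro conjI)
  show "D \<subseteq> \<F>" by (rule assms(1))
qed (intro ballI impI, (elim conjE)?, rule assms(2-3); assumption)+

definition down_sets :: "'a set \<Rightarrow> 'a rel \<Rightarrow> 'a set set" where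
  "down_sets I P = {A. down_set I P A}"

text \<open>
  Taking \<open>E = B - A\<close> in the decomposition gives the equality, and finiteness of \<open>z(B)\<close> forces
  finiteness of both summands.  Conversely, write \<open>c\<close> for the minor; submodularity gives
  \<open>c(E) \<le> c(E \<inter> C1) + c(E \<inter> C2)\<close>, \<open>c(E \<union> C1) + c(E \<inter> C1) \<le> c(E) + c(C1)\<close> and
  \<open>c(C1 \<union> C2) + c(E \<inter> C2) \<le> c(E \<union> C1) + c(C2)\<close>, and the sum of the last two is the reverse of
  the first because \<open>c(C1 \<union> C2) = c(C1) + c(C2)\<close>.
\<close>

lemma decomposes_along_minor_iff:
  assumes sm: "submodular I z" and A: "A \<in> finite_valued I z" and B: "B \<in> finite_valued I z"
    and AB: "A \<subseteq> B" and part: "B - A = C1 \<union> C2" "C1 \<inter> C2 = {}"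
  shows "decomposes_along (sm_minor z B A) (B - A) C1 C2 \<longleftrightarrow>
    A \<union> C1 \<in> finite_valued I z \<and> A \<union> C2 \<in> finite_valued I z \<and>
    real_value z B + real_value z A = real_value z (A \<union> C1) + real_value z (A \<union> C2)"
proof -
  let ?F = "finite_valued I z" and ?r = "real_value z"
  note ev = ereal_real_value[OF sm]
  note sub = submodular_onD[OF submodular_on_finite_valued[OF sm]]
  have BI: "B \<subseteq> I" using B unfolding finite_valued_def by auto
  have val: "sm_minor z B A E = z (A \<union> E) - z A" if "E \<subseteq> B - A" for E
  proof -
    have "A \<union> E \<subseteq> B" using that AB by blast
    then show ?thesis using that AB
      by (simp add: sm_minor_def sm_contract_def sm_restrict_def)
  qed
  have inI: "A \<union> E \<subseteq> I" if "E \<subseteq> B - A" for E using that AB BI by blast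
  have fin: "sm_minor z B A E = ereal (?r (A \<union> E) - ?r A)" if "E \<subseteq> B - A" "A \<union> E \<in> ?F" for E
    using val[OF that(1)] ev[OF that(2)] ev[OF A] by simp
  have inf: "sm_minor z B A E = \<infinity>" if "E \<subseteq> B - A" "A \<union> E \<notin> ?F" for E
    using val[OF that(1)] infinite_value[OF inI[OF that(1)] that(2)] ev[OF A] by simp
  have C: "C1 \<subseteq> B - A" "C2 \<subseteq> B - A" using part by auto
  have AC: "A \<union> (B - A) = B" using AB by auto
  show ?thesis
  proof
    assume "decomposes_along (sm_minor z B A) (B - A) C1 C2"
    then have "sm_minor z B A (B - A)
        = sm_minor z B A ((B - A) \<inter> C1) + sm_minor z B A ((B - A) \<inter> C2)"
      unfolding decomposes_along_def by blast
    moreover have "(B - A) \<inter> C1 = C1" "(B - A) \<inter> C2 = C2" using C by auto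
    ultimately have e: "ereal (?r B - ?r A) = sm_minor z B A C1 + sm_minor z B A C2"
      using fin[of "B - A"] AC B by simp
    have ni: "sm_minor z B A E \<noteq> -\<infinity>" if "E \<subseteq> B - A" for E
      using fin[OF that] inf[OF that] by (cases "A \<union> E \<in> ?F") auto
    have f1: "A \<union> C1 \<in> ?F"
    proof (rule ccontr)
      assume "A \<union> C1 \<notin> ?F"
      then show False using e inf[OF C(1)] ni[OF C(2)] by simp
    qed
    have f2: "A \<union> C2 \<in> ?F"
    proof (rule ccontr)
      assume "A \<union> C2 \<notin> ?F"
      then show False using e inf[OF C(2)] ni[OF C(1)] by simp
    qed
    show "A \<union> C1 \<in> ?F \<and> A \<union> C2 \<in> ?F \<and> ?r B + ?r A = ?r (A \<union> C1) + ?r (A \<union> C2)"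
      using e f1 f2 fin[OF C(1) f1] fin[OF C(2) f2] by simp
  next
    assume R: "A \<union> C1 \<in> ?F \<and> A \<union> C2 \<in> ?F \<and> ?r B + ?r A = ?r (A \<union> C1) + ?r (A \<union> C2)"
    have "sm_minor z B A E = sm_minor z B A (E \<inter> C1) + sm_minor z B A (E \<inter> C2)"
      if E: "E \<subseteq> B - A" for E
    proof -
      have E12: "E \<inter> C1 \<subseteq> B - A" "E \<inter> C2 \<subseteq> B - A" using E by auto
      have u: "(A \<union> (E \<inter> C1)) \<union> (A \<union> (E \<inter> C2)) = A \<union> E" using E part by blast
      have i: "(A \<union> (E \<inter> C1)) \<inter> (A \<union> (E \<inter> C2)) = A" using E part by blast
      show ?thesis
      proof (cases "A \<union> E \<in> ?F")
        case True
        have i1: "(A \<union> E) \<inter> (A \<union> C1) = A \<union> (E \<inter> C1)" by blast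
        have i2: "(A \<union> E \<union> C1) \<inter> (A \<union> C2) = A \<union> (E \<inter> C2)" using part by blast
        have u1: "(A \<union> E) \<union> (A \<union> C1) = A \<union> E \<union> C1" by blast
        have u2: "(A \<union> E \<union> C1) \<union> (A \<union> C2) = B" using part E AB by blast
        have f1: "A \<union> (E \<inter> C1) \<in> ?F" and fu: "A \<union> E \<union> C1 \<in> ?F"
          and l1: "?r (A \<union> E \<union> C1) + ?r (A \<union> (E \<inter> C1)) \<le> ?r (A \<union> E) + ?r (A \<union> C1)"
          using sub[of "A \<union> E" "A \<union> C1"] True R unfolding i1 u1 by blast+
        have f2: "A \<union> (E \<inter> C2) \<in> ?F"
          and l2: "?r B + ?r (A \<union> (E \<inter> C2)) \<le> ?r (A \<union> E \<union> C1) + ?r (A \<union> C2)"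
          using sub[of "A \<union> E \<union> C1" "A \<union> C2"] fu R unfolding i2 u2 by blast+
        have l3: "?r (A \<union> E) + ?r A \<le> ?r (A \<union> (E \<inter> C1)) + ?r (A \<union> (E \<inter> C2))"
          using sub(3)[OF f1 f2] unfolding u i .
        have "?r (A \<union> E) - ?r A = (?r (A \<union> (E \<inter> C1)) - ?r A) + (?r (A \<union> (E \<inter> C2)) - ?r A)"
          using l1 l2 l3 R by linarith
        then show ?thesis
          using fin[OF E True] fin[OF E12(1) f1] fin[OF E12(2) f2] by simp
      next
        case False
        then have "A \<union> (E \<inter> C1) \<notin> ?F \<or> A \<union> (E \<inter> C2) \<notin> ?F"
          using sub(1) u by metis
        then show ?thesis
          using inf[OF E False] inf[OF E12(1)] inf[OF E12(2)] by auto
      qed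
    qed
    then show "decomposes_along (sm_minor z B A) (B - A) C1 C2"
      using part unfolding decomposes_along_def by blast
  qed
qed

lemma disconnected_union_iff:
  assumes "A \<in> down_sets I P" "B \<in> down_sets I P" "A \<subseteq> B"
    and "B - A = C1 \<union> C2" "C1 \<inter> C2 = {}"
  shows "disconnected_union P (B - A) C1 C2 \<longleftrightarrow> A \<union> C1 \<in> down_sets I P \<and> A \<union> C2 \<in> down_sets I P"
proof
  assume d: "disconnected_union P (B - A) C1 C2"
  have "down_set I P (A \<union> C)" if "C = C1 \<or> C = C2" for C
    using assms d that unfolding down_sets_def down_set_def disconnected_union_def by blast
  then show "A \<union> C1 \<in> down_sets I P \<and> A \<union> C2 \<in> down_sets I P"
    unfolding down_sets_def by blast
next
  assume "A \<union> C1 \<in> down_sets I P \<and> A \<union> C2 \<in> down_sets I P"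
  then have d: "down_set I P (A \<union> C1)" "down_set I P (A \<union> C2)" unfolding down_sets_def by auto
  have "(a, b) \<notin> P \<and> (b, a) \<notin> P" if "a \<in> C1" "b \<in> C2" for a b
  proof -
    have "b \<notin> A \<union> C1" "a \<notin> A \<union> C2" using that assms(4,5) by blast+
    then show ?thesis using d that unfolding down_set_def by blast
  qed
  then show "disconnected_union P (B - A) C1 C2"
    using assms(4,5) unfolding disconnected_union_def by blast
qed

lemma down_sets_Un: "X \<in> down_sets I P \<Longrightarrow> Y \<in> down_sets I P \<Longrightarrow> X \<union> Y \<in> down_sets I P"
  and down_sets_Int: "X \<in> down_sets I P \<Longrightarrow> Y \<in> down_sets I P \<Longrightarrow> X \<inter> Y \<in> down_sets I P"
  unfolding down_sets_def down_set_def by blast+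

text \<open>
  Pairs \<open>A \<subseteq> B\<close> of down-sets together with a partition \<open>B - A = C1 \<squnion> C2\<close> are the same as pairs
  \<open>X, Y\<close> whose union and intersection are down-sets: take \<open>X = A \<union> C1\<close> and \<open>Y = A \<union> C2\<close>, and
  conversely \<open>C1 = X - Y\<close> and \<open>C2 = Y - X\<close>.
\<close>

lemma conforms_iff:
  assumes sm: "submodular I z"
  shows "conforms I z P \<longleftrightarrow>
    preorder_on I P \<and> conforming_family (finite_valued I z) (real_value z) (down_sets I P)"
    (is "_ \<longleftrightarrow> _ \<and> conforming_family ?F ?r ?D")
proof
  assume c: "conforms I z P"
  then have comp: "compatible I z P" unfolding conforms_def by blast
  then have pre: "preorder_on I P" unfolding compatible_def by simp
  have fin: "z A < \<infinity>" if "A \<in> ?D" for A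
    using comp that unfolding compatible_def down_sets_def by simp
  have "A \<subseteq> I" if "A \<in> ?D" for A
    using that unfolding down_sets_def down_set_def by simp
  with fin have DF: "?D \<subseteq> ?F"
    unfolding finite_valued_def subset_iff by simp
  have main: "(X \<in> ?D \<and> Y \<in> ?D) \<longleftrightarrow> ?r (X \<union> Y) + ?r (X \<inter> Y) = ?r X + ?r Y"
    if XY: "X \<in> ?F" "Y \<in> ?F" "X \<union> Y \<in> ?D" "X \<inter> Y \<in> ?D" for X Y
  proof -
    let ?A = "X \<inter> Y" and ?B = "X \<union> Y"
    have p: "?A \<subseteq> ?B" "?B - ?A = (X - Y) \<union> (Y - X)" "(X - Y) \<inter> (Y - X) = {}" by blast+
    have e: "?A \<union> (X - Y) = X" "?A \<union> (Y - X) = Y" by blast+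
    have "disconnected_union P (?B - ?A) (X - Y) (Y - X) \<longleftrightarrow>
        decomposes_along (sm_minor z ?B ?A) (?B - ?A) (X - Y) (Y - X)"
      using c comp XY(3,4) p(1) unfolding conforms_def compatible_def down_sets_def by blast
    then show ?thesis
      using disconnected_union_iff[OF XY(4,3) p]
        decomposes_along_minor_iff[OF sm _ _ p] XY DF unfolding e by blast
  qed
  have "conforming_family ?F ?r ?D"
  proof (rule conforming_familyI)
    show "?D \<subseteq> ?F" by (rule DF)
    show "?r (X \<union> Y) + ?r (X \<inter> Y) = ?r X + ?r Y" if "X \<in> ?D" "Y \<in> ?D" for X Y
      using main[of X Y] that DF down_sets_Un[OF that] down_sets_Int[OF that] by blast
  qed (use main in blast)+
  with pre show "preorder_on I P \<and> conforming_family ?F ?r ?D" ..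
next
  assume R: "preorder_on I P \<and> conforming_family ?F ?r ?D"
  then have DF: "?D \<subseteq> ?F"
    and modular: "\<And>X Y. X \<in> ?D \<Longrightarrow> Y \<in> ?D \<Longrightarrow> ?r (X \<union> Y) + ?r (X \<inter> Y) = ?r X + ?r Y"
    and factor: "\<And>X Y. X \<in> ?F \<Longrightarrow> Y \<in> ?F \<Longrightarrow> X \<union> Y \<in> ?D \<Longrightarrow> X \<inter> Y \<in> ?D \<Longrightarrow>
        ?r (X \<union> Y) + ?r (X \<inter> Y) = ?r X + ?r Y \<Longrightarrow> X \<in> ?D \<and> Y \<in> ?D"
    unfolding conforming_family_def by blast+
  have main: "disconnected_union P (B - A) C1 C2 \<longleftrightarrow>
      decomposes_along (sm_minor z B A) (B - A) C1 C2"
    if d: "down_set I P A" "down_set I P B" and AB: "A \<subseteq> B" for A B C1 C2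
  proof (cases "B - A = C1 \<union> C2 \<and> C1 \<inter> C2 = {}")
    case False
    then show ?thesis unfolding disconnected_union_def decomposes_along_def by blast
  next
    case True
    then have p: "B - A = C1 \<union> C2" "C1 \<inter> C2 = {}" by auto
    have D: "A \<in> ?D" "B \<in> ?D" using d unfolding down_sets_def by auto
    have e: "(A \<union> C1) \<union> (A \<union> C2) = B" "(A \<union> C1) \<inter> (A \<union> C2) = A" using p AB by blast+
    have "A \<union> C1 \<in> ?D \<and> A \<union> C2 \<in> ?D \<longleftrightarrow>
        A \<union> C1 \<in> ?F \<and> A \<union> C2 \<in> ?F \<and> ?r B + ?r A = ?r (A \<union> C1) + ?r (A \<union> C2)"
      using modular[of "A \<union> C1" "A \<union> C2"] factor[of "A \<union> C1" "A \<union> C2"] DF D unfolding e by blast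
    then show ?thesis
      using disconnected_union_iff[OF D AB p] decomposes_along_minor_iff[OF sm _ _ AB p] D DF
      by blast
  qed
  have "z A < \<infinity>" if "down_set I P A" for A
    using that DF unfolding down_sets_def finite_valued_def by blast
  with R main show "conforms I z P"
    unfolding conforms_def compatible_def by blast
qed

section \<open>Cutting and gluing families of sets\<close>

definition restrict_family :: "'a set set \<Rightarrow> 'a set \<Rightarrow> 'a set set" where
  "restrict_family D S = {X \<in> D. X \<subseteq> S}"

definition contract_family :: "'a set set \<Rightarrow> 'a set \<Rightarrow> 'a set set" where
  "contract_family D S = {U. U \<inter> S = {} \<and> S \<union> U \<in> D}"

definition glue_families ::
    "'a set set \<Rightarrow> ('a set \<Rightarrow> real) \<Rightarrow> 'a set \<Rightarrow> 'a set set \<Rightarrow> 'a set set \<Rightarrow> 'a set set" where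
  "glue_families \<F> r S D1 D2 =
     {X \<in> \<F>. X \<inter> S \<in> D1 \<and> X - S \<in> D2 \<and> r (X \<union> S) + r (X \<inter> S) = r X + r S}"

lemma conforming_family_restrict:
  assumes c: "conforming_family \<F> r D"
  shows "conforming_family (restrict_family \<F> S) r (restrict_family D S)"
proof (rule conforming_familyI)
  show "restrict_family D S \<subseteq> restrict_family \<F> S"
    using conforming_familyD(1)[OF c] unfolding restrict_family_def by blast
next
  fix X Y assume "X \<in> restrict_family D S" "Y \<in> restrict_family D S"
  then show "r (X \<union> Y) + r (X \<inter> Y) = r X + r Y"
    using conforming_familyD(2)[OF c] unfolding restrict_family_def by simp
next
  fix X Y assume "X \<in> restrict_family \<F> S" "Y \<in> restrict_family \<F> S"
    "X \<union> Y \<in> restrict_family D S" "X \<inter> Y \<in> restrict_family D S"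
    "r (X \<union> Y) + r (X \<inter> Y) = r X + r Y"
  then show "X \<in> restrict_family D S \<and> Y \<in> restrict_family D S"
    using conforming_familyD(3)[OF c, of X Y] unfolding restrict_family_def by simp
qed

lemma conforming_family_contract:
  assumes c: "conforming_family \<F> r D"
  shows "conforming_family (contract_family \<F> S) (\<lambda>U. r (S \<union> U) - r S) (contract_family D S)"
proof -
  have u: "S \<union> (X \<union> Y) = (S \<union> X) \<union> (S \<union> Y)" "S \<union> (X \<inter> Y) = (S \<union> X) \<inter> (S \<union> Y)" for X Y
    by blast+
  show ?thesis
  proof (rule conforming_familyI)
    show "contract_family D S \<subseteq> contract_family \<F> S"
      using conforming_familyD(1)[OF c] unfolding contract_family_def by blast
  next
    fix X Y assume "X \<in> contract_family D S" "Y \<in> contract_family D S"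
    then show "r (S \<union> (X \<union> Y)) - r S + (r (S \<union> (X \<inter> Y)) - r S)
        = r (S \<union> X) - r S + (r (S \<union> Y) - r S)"
      using conforming_familyD(2)[OF c, of "S \<union> X" "S \<union> Y", folded u]
      unfolding contract_family_def by simp
  next
    fix X Y assume "X \<in> contract_family \<F> S" "Y \<in> contract_family \<F> S"
      "X \<union> Y \<in> contract_family D S" "X \<inter> Y \<in> contract_family D S"
      "r (S \<union> (X \<union> Y)) - r S + (r (S \<union> (X \<inter> Y)) - r S)
        = r (S \<union> X) - r S + (r (S \<union> Y) - r S)"
    then show "X \<in> contract_family D S \<and> Y \<in> contract_family D S"
      using conforming_familyD(3)[OF c, of "S \<union> X" "S \<union> Y", folded u]
      unfolding contract_family_def by simp
  qed
qed

text \<open>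
  A conforming family is recovered from its two parts: modularity at \<open>X, S\<close> gives one inclusion,
  and the converse condition at \<open>X, S\<close> the other.
\<close>

lemma glue_families_of_parts:
  assumes c: "conforming_family \<F> r D" and S: "S \<in> D"
    and un: "\<And>X Y. X \<in> D \<Longrightarrow> Y \<in> D \<Longrightarrow> X \<union> Y \<in> D"
    and int: "\<And>X Y. X \<in> D \<Longrightarrow> Y \<in> D \<Longrightarrow> X \<inter> Y \<in> D"
  shows "glue_families \<F> r S (restrict_family D S) (contract_family D S) = D"
proof (intro set_eqI iffI)
  fix X assume X: "X \<in> D"
  have "S \<union> (X - S) = X \<union> S" by blast
  then show "X \<in> glue_families \<F> r S (restrict_family D S) (contract_family D S)"
    using X un[OF X S] int[OF X S] conforming_familyD(1)[OF c] conforming_familyD(2)[OF c X S]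
    unfolding glue_families_def restrict_family_def contract_family_def by auto
next
  fix X assume X: "X \<in> glue_families \<F> r S (restrict_family D S) (contract_family D S)"
  have "S \<union> (X - S) = X \<union> S" by blast
  then have "X \<in> \<F>" "X \<inter> S \<in> D" "X \<union> S \<in> D" "r (X \<union> S) + r (X \<inter> S) = r X + r S"
    using X unfolding glue_families_def restrict_family_def contract_family_def by auto
  moreover have "S \<in> \<F>" using conforming_familyD(1)[OF c] S by blast
  ultimately show "X \<in> D" using conforming_familyD(3)[OF c] by blast
qed

context
  fixes \<F> :: "'a set set" and r :: "'a set \<Rightarrow> real" and S :: "'a set" and D1 D2
  assumes sm: "submodular_on \<F> r" and S: "S \<in> \<F>"
    and D1: "conforming_family (restrict_family \<F> S) r D1"
    and D2: "conforming_family (contract_family \<F> S) (\<lambda>U. r (S \<union> U) - r S) D2"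
begin

text \<open>
  With \<open>f(X) = r(X \<inter> S) + r(X \<union> S) - r(S)\<close>, the first inequality is \<open>f \<le> r\<close>, and the other two
  add up to submodularity of \<open>f\<close>.
\<close>

lemma crossing_inequality:
  assumes X: "X \<in> \<F>" and Y: "Y \<in> \<F>"
  shows "r (X \<inter> S) + r (X \<union> S) \<le> r X + r S"
    and "r ((X \<union> Y) \<inter> S) + r ((X \<inter> Y) \<inter> S) \<le> r (X \<inter> S) + r (Y \<inter> S)"
    and "r ((X \<union> Y) \<union> S) + r ((X \<inter> Y) \<union> S) \<le> r (X \<union> S) + r (Y \<union> S)"
proof -
  note s = submodular_onD[OF sm]
  show "r (X \<inter> S) + r (X \<union> S) \<le> r X + r S" using s(3)[OF X S] by simp
  have "(X \<inter> S) \<union> (Y \<inter> S) = (X \<union> Y) \<inter> S" "(X \<inter> S) \<inter> (Y \<inter> S) = (X \<inter> Y) \<inter> S" by blast+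
  then show "r ((X \<union> Y) \<inter> S) + r ((X \<inter> Y) \<inter> S) \<le> r (X \<inter> S) + r (Y \<inter> S)"
    using s(3)[OF s(2)[OF X S] s(2)[OF Y S]] by simp
  have "(X \<union> S) \<union> (Y \<union> S) = (X \<union> Y) \<union> S" "(X \<union> S) \<inter> (Y \<union> S) = (X \<inter> Y) \<union> S" by blast+
  then show "r ((X \<union> Y) \<union> S) + r ((X \<inter> Y) \<union> S) \<le> r (X \<union> S) + r (Y \<union> S)"
    using s(3)[OF s(1)[OF X S] s(1)[OF Y S]] by simp
qed

text \<open>The two equations add up to modularity of \<open>f\<close>.\<close>

lemma modular_parts:
  assumes "X \<inter> S \<in> D1" "X - S \<in> D2" "Y \<inter> S \<in> D1" "Y - S \<in> D2"
  shows "r ((X \<union> Y) \<inter> S) + r ((X \<inter> Y) \<inter> S) = r (X \<inter> S) + r (Y \<inter> S)"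
    and "r ((X \<union> Y) \<union> S) + r ((X \<inter> Y) \<union> S) = r (X \<union> S) + r (Y \<union> S)"
proof -
  have e: "(X \<inter> S) \<union> (Y \<inter> S) = (X \<union> Y) \<inter> S" "(X \<inter> S) \<inter> (Y \<inter> S) = (X \<inter> Y) \<inter> S" by blast+
  show "r ((X \<union> Y) \<inter> S) + r ((X \<inter> Y) \<inter> S) = r (X \<inter> S) + r (Y \<inter> S)"
    using conforming_familyD(2)[OF D1 assms(1,3)] unfolding e .
  have f: "S \<union> (Z - S) = Z \<union> S" "S \<union> ((X - S) \<union> (Y - S)) = (X \<union> Y) \<union> S"
    "S \<union> ((X - S) \<inter> (Y - S)) = (X \<inter> Y) \<union> S" for Z by blast+
  have "(r (S \<union> ((X - S) \<union> (Y - S))) - r S) + (r (S \<union> ((X - S) \<inter> (Y - S))) - r S)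
      = (r (S \<union> (X - S)) - r S) + (r (S \<union> (Y - S)) - r S)"
    by (rule conforming_familyD(2)[OF D2 assms(2,4)])
  then show "r ((X \<union> Y) \<union> S) + r ((X \<inter> Y) \<union> S) = r (X \<union> S) + r (Y \<union> S)"
    unfolding f by simp
qed

text \<open>
  On the glued family \<open>r = f\<close>, so
  \<open>r(X) + r(Y) \<ge> r(X \<union> Y) + r(X \<inter> Y) \<ge> f(X \<union> Y) + f(X \<inter> Y) = f(X) + f(Y) = r(X) + r(Y)\<close>.
  Everything is an equality, which yields modularity of \<open>r\<close> and \<open>r = f\<close> at the union and at the
  intersection.
\<close>

lemma glue_families_lattice:
  assumes un1: "\<And>X Y. X \<in> D1 \<Longrightarrow> Y \<in> D1 \<Longrightarrow> X \<union> Y \<in> D1"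
    and int1: "\<And>X Y. X \<in> D1 \<Longrightarrow> Y \<in> D1 \<Longrightarrow> X \<inter> Y \<in> D1"
    and un2: "\<And>X Y. X \<in> D2 \<Longrightarrow> Y \<in> D2 \<Longrightarrow> X \<union> Y \<in> D2"
    and int2: "\<And>X Y. X \<in> D2 \<Longrightarrow> Y \<in> D2 \<Longrightarrow> X \<inter> Y \<in> D2"
    and X: "X \<in> glue_families \<F> r S D1 D2" and Y: "Y \<in> glue_families \<F> r S D1 D2"
  shows "X \<union> Y \<in> glue_families \<F> r S D1 D2" (is ?U)
    and "X \<inter> Y \<in> glue_families \<F> r S D1 D2" (is ?I)
    and "r (X \<union> Y) + r (X \<inter> Y) = r X + r Y" (is ?M)
proof -
  have x: "X \<in> \<F>" "X \<inter> S \<in> D1" "X - S \<in> D2" "r (X \<union> S) + r (X \<inter> S) = r X + r S"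
    and y: "Y \<in> \<F>" "Y \<inter> S \<in> D1" "Y - S \<in> D2" "r (Y \<union> S) + r (Y \<inter> S) = r Y + r S"
    using X Y unfolding glue_families_def by auto
  note s = submodular_onD[OF sm x(1) y(1)]
  note m = modular_parts[OF x(2,3) y(2,3)]
  have "r (X \<union> Y) + r (X \<inter> Y) = r X + r Y \<and>
      r (X \<union> Y \<union> S) + r ((X \<union> Y) \<inter> S) = r (X \<union> Y) + r S \<and>
      r (X \<inter> Y \<union> S) + r ((X \<inter> Y) \<inter> S) = r (X \<inter> Y) + r S"
    using m s(3) x(4) y(4) crossing_inequality(1)[OF s(1,1)] crossing_inequality(1)[OF s(2,2)]
    by linarith
  moreover have e: "(X \<inter> S) \<union> (Y \<inter> S) = (X \<union> Y) \<inter> S" "(X \<inter> S) \<inter> (Y \<inter> S) = (X \<inter> Y) \<inter> S"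
    "(X - S) \<union> (Y - S) = (X \<union> Y) - S" "(X - S) \<inter> (Y - S) = (X \<inter> Y) - S" by blast+
  have "(X \<union> Y) \<inter> S \<in> D1" "(X \<inter> Y) \<inter> S \<in> D1" "(X \<union> Y) - S \<in> D2" "(X \<inter> Y) - S \<in> D2"
    using un1[OF x(2) y(2)] int1[OF x(2) y(2)] un2[OF x(3) y(3)] int2[OF x(3) y(3)]
    unfolding e by blast+
  ultimately show ?U ?I ?M using s unfolding glue_families_def by auto
qed

text \<open>
  Here the chain runs the other way:
  \<open>r(X) + r(Y) \<ge> f(X) + f(Y) \<ge> f(X \<union> Y) + f(X \<inter> Y) = r(X \<union> Y) + r(X \<inter> Y) = r(X) + r(Y)\<close>.
  Equality in the first step gives \<open>r = f\<close> at \<open>X\<close> and \<open>Y\<close>; equality in the second step holds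
  separately for the parts below and above \<open>S\<close>, so the converse condition of \<open>D1\<close> and of \<open>D2\<close>
  applies to them.
\<close>

lemma glue_families_factor:
  assumes X: "X \<in> \<F>" and Y: "Y \<in> \<F>"
    and U: "X \<union> Y \<in> glue_families \<F> r S D1 D2" and I: "X \<inter> Y \<in> glue_families \<F> r S D1 D2"
    and eq: "r (X \<union> Y) + r (X \<inter> Y) = r X + r Y"
  shows "X \<in> glue_families \<F> r S D1 D2 \<and> Y \<in> glue_families \<F> r S D1 D2"
proof -
  have u: "(X \<union> Y) \<inter> S \<in> D1" "(X \<union> Y) - S \<in> D2"
      "r (X \<union> Y \<union> S) + r ((X \<union> Y) \<inter> S) = r (X \<union> Y) + r S"
    and i: "(X \<inter> Y) \<inter> S \<in> D1" "(X \<inter> Y) - S \<in> D2"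
      "r (X \<inter> Y \<union> S) + r ((X \<inter> Y) \<inter> S) = r (X \<inter> Y) + r S"
    using U I unfolding glue_families_def by auto
  note s = submodular_onD[OF sm]
  have all: "r (X \<union> S) + r (X \<inter> S) = r X + r S" "r (Y \<union> S) + r (Y \<inter> S) = r Y + r S"
    "r ((X \<union> Y) \<inter> S) + r ((X \<inter> Y) \<inter> S) = r (X \<inter> S) + r (Y \<inter> S)"
    "r ((X \<union> Y) \<union> S) + r ((X \<inter> Y) \<union> S) = r (X \<union> S) + r (Y \<union> S)"
    using crossing_inequality[OF X Y] crossing_inequality(1)[OF Y X] eq u(3) i(3) by linarith+
  have e: "(X \<inter> S) \<union> (Y \<inter> S) = (X \<union> Y) \<inter> S" "(X \<inter> S) \<inter> (Y \<inter> S) = (X \<inter> Y) \<inter> S"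
    "(X - S) \<union> (Y - S) = (X \<union> Y) - S" "(X - S) \<inter> (Y - S) = (X \<inter> Y) - S"
    "S \<union> (Z - S) = Z \<union> S" for Z by blast+
  have "X \<inter> S \<in> restrict_family \<F> S" "Y \<inter> S \<in> restrict_family \<F> S"
    using s(2)[OF X S] s(2)[OF Y S] unfolding restrict_family_def by auto
  then have "X \<inter> S \<in> D1 \<and> Y \<inter> S \<in> D1"
    by (rule conforming_familyD(3)[OF D1]) (use u(1) i(1) all(3) in \<open>simp_all add: e(1,2)\<close>)
  moreover
  have "X - S \<in> contract_family \<F> S" "Y - S \<in> contract_family \<F> S"
    using s(1)[OF X S] s(1)[OF Y S] unfolding contract_family_def by (auto simp: Un_commute)
  moreover have "(r (S \<union> ((X \<union> Y) - S)) - r S) + (r (S \<union> ((X \<inter> Y) - S)) - r S)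
      = (r (S \<union> (X - S)) - r S) + (r (S \<union> (Y - S)) - r S)"
    unfolding e(5) using all(4) by simp
  ultimately have "X \<inter> S \<in> D1 \<and> Y \<inter> S \<in> D1 \<and> X - S \<in> D2 \<and> Y - S \<in> D2"
    using conforming_familyD(3)[OF D2, of "X - S" "Y - S", unfolded e(3,4)] u(2) i(2) by blast
  then show ?thesis using X Y all(1,2) unfolding glue_families_def by auto
qed

lemma restrict_glue_families:
  assumes "{} \<in> D2"
  shows "restrict_family (glue_families \<F> r S D1 D2) S = D1"
proof (intro set_eqI iffI)
  fix X assume "X \<in> D1"
  then have X: "X \<in> \<F>" "X \<subseteq> S" "X \<in> D1"
    using D1 unfolding conforming_family_def restrict_family_def by auto
  then have e: "X \<inter> S = X" "X - S = {}" "X \<union> S = S" by auto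
  show "X \<in> restrict_family (glue_families \<F> r S D1 D2) S"
    using X assms unfolding restrict_family_def glue_families_def by (simp add: e)
qed (auto simp: restrict_family_def glue_families_def Int_absorb2)

lemma contract_glue_families:
  assumes "S \<in> D1"
  shows "contract_family (glue_families \<F> r S D1 D2) S = D2"
proof (intro set_eqI iffI)
  fix U assume "U \<in> D2"
  then have U: "S \<union> U \<in> \<F>" "U \<inter> S = {}" "U \<in> D2"
    using D2 unfolding conforming_family_def contract_family_def by auto
  then have e: "(S \<union> U) \<inter> S = S" "(S \<union> U) - S = U" "S \<union> U \<union> S = S \<union> U" by auto
  show "U \<in> contract_family (glue_families \<F> r S D1 D2) S"
    using U assms unfolding contract_family_def glue_families_def by (simp add: e)
next
  fix U assume "U \<in> contract_family (glue_families \<F> r S D1 D2) S"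
  moreover from this have "(S \<union> U) - S = U" unfolding contract_family_def by auto
  ultimately show "U \<in> D2" unfolding contract_family_def glue_families_def by auto
qed

end

section \<open>Preorders and rings of sets\<close>

definition preorder_of_family :: "'a set \<Rightarrow> 'a set set \<Rightarrow> 'a rel" where
  "preorder_of_family I D = {(a, b) \<in> I \<times> I. \<forall>X\<in>D. b \<in> X \<longrightarrow> a \<in> X}"

lemma preorder_on_preorder_of_family: "preorder_on I (preorder_of_family I D)"
  unfolding preorder_on_def preorder_of_family_def refl_on_def trans_def by auto

lemma preorder_of_down_sets:
  assumes "preorder_on I P"
  shows "preorder_of_family I (down_sets I P) = P"
proof -
  have P: "P \<subseteq> I \<times> I" "\<And>a. a \<in> I \<Longrightarrow> (a, a) \<in> P"
    "\<And>a b c. (a, b) \<in> P \<Longrightarrow> (b, c) \<in> P \<Longrightarrow> (a, c) \<in> P"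
    using assms unfolding preorder_on_def refl_on_def by (auto dest: transD)
  have principal: "{a. (a, b) \<in> P} \<in> down_sets I P" for b
    using P unfolding down_sets_def down_set_def by blast
  show ?thesis
  proof
    show "P \<subseteq> preorder_of_family I (down_sets I P)"
      using P(1) unfolding preorder_of_family_def down_sets_def down_set_def by blast
    show "preorder_of_family I (down_sets I P) \<subseteq> P"
    proof (rule subrelI)
      fix a b assume "(a, b) \<in> preorder_of_family I (down_sets I P)"
      then have b: "b \<in> I" and below: "X \<in> down_sets I P \<Longrightarrow> b \<in> X \<Longrightarrow> a \<in> X" for X
        unfolding preorder_of_family_def by simp_all
      show "(a, b) \<in> P" using below[OF principal[of b]] P(2)[OF b] by simp
    qed
  qed
qed

lemma down_sets_inject:
  assumes "preorder_on I P" "preorder_on I Q" "down_sets I P = down_sets I Q"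
  shows "P = Q"
  using assms preorder_of_down_sets by metis

text \<open>
  A down-set \<open>X\<close> is the union of the members of \<open>D\<close> inside it: each \<open>b \<in> X\<close> lies in the smallest
  member of \<open>D\<close> containing \<open>b\<close>, which is the principal down-set of \<open>b\<close>.
\<close>

lemma down_sets_preorder_of_family:
  assumes fin: "finite I" and DI: "D \<subseteq> Pow I" and "{} \<in> D" "I \<in> D"
    and un: "\<And>X Y. X \<in> D \<Longrightarrow> Y \<in> D \<Longrightarrow> X \<union> Y \<in> D"
    and int: "\<And>X Y. X \<in> D \<Longrightarrow> Y \<in> D \<Longrightarrow> X \<inter> Y \<in> D"
  shows "down_sets I (preorder_of_family I D) = D"
proof (intro set_eqI iffI)
  fix X assume X: "X \<in> down_sets I (preorder_of_family I D)"
  then have XI: "X \<subseteq> I" unfolding down_sets_def down_set_def by auto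
  let ?N = "\<lambda>b. \<Inter>{Y \<in> D. b \<in> Y}"
  have fD: "finite D" using fin DI finite_subset by auto
  have N: "?N b \<in> {Y \<in> D. b \<in> Y}" if "b \<in> X" for b
  proof (rule finite_Inf_in)
    show "{Y \<in> D. b \<in> Y} \<noteq> {}" using that XI \<open>I \<in> D\<close> by blast
  qed (use fD int in auto)
  have NX: "?N b \<subseteq> X" if b: "b \<in> X" for b
  proof
    fix a assume a: "a \<in> ?N b"
    then have "a \<in> I" "b \<in> I" using b XI \<open>I \<in> D\<close> by auto
    then have "(a, b) \<in> preorder_of_family I D"
      using a unfolding preorder_of_family_def by auto
    then show "a \<in> X" using X b unfolding down_sets_def down_set_def by blast
  qed
  have "\<Union>{Y \<in> D. Y \<subseteq> X} \<in> {Y \<in> D. Y \<subseteq> X}"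
  proof (rule finite_Sup_in)
    show "{Y \<in> D. Y \<subseteq> X} \<noteq> {}" using \<open>{} \<in> D\<close> by blast
  qed (use fD un in auto)
  moreover have "X = \<Union>{Y \<in> D. Y \<subseteq> X}"
  proof
    show "X \<subseteq> \<Union>{Y \<in> D. Y \<subseteq> X}"
    proof
      fix b assume "b \<in> X"
      then have "?N b \<in> D" "b \<in> ?N b" "?N b \<subseteq> X" using N NX by auto
      then show "b \<in> \<Union>{Y \<in> D. Y \<subseteq> X}" by blast
    qed
  qed blast
  ultimately show "X \<in> D" by simp
next
  fix X assume "X \<in> D"
  then show "X \<in> down_sets I (preorder_of_family I D)"
    using DI unfolding down_sets_def down_set_def preorder_of_family_def by auto
qed

lemma trivial_down_sets:
  assumes "preorder_on I P"
  shows "{} \<in> down_sets I P" "I \<in> down_sets I P"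
  using assms unfolding down_sets_def down_set_def preorder_on_def by auto

lemma preorder_on_Restr:
  assumes "preorder_on I P" "S \<subseteq> I"
  shows "preorder_on S (Restr P S)"
  using assms unfolding preorder_on_def refl_on_def trans_def by blast

lemma down_sets_Restr_down_set:
  assumes "S \<in> down_sets I P"
  shows "down_sets S (Restr P S) = restrict_family (down_sets I P) S"
  using assms unfolding down_sets_def down_set_def restrict_family_def by blast

lemma down_sets_Restr_complement:
  assumes "preorder_on I P" "S \<in> down_sets I P"
  shows "down_sets (I - S) (Restr P (I - S)) = contract_family (down_sets I P) S"
proof -
  have "P \<subseteq> I \<times> I" using assms(1) unfolding preorder_on_def by auto
  then show ?thesis
    using assms(2) unfolding down_sets_def down_set_def contract_family_def by blast
qed

section \<open>Restriction and contraction of a submodular function\<close>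

lemma finite_valued_restrict:
  assumes "S \<subseteq> I"
  shows "finite_valued S (sm_restrict z S) = restrict_family (finite_valued I z) S"
  using assms unfolding finite_valued_def restrict_family_def sm_restrict_def by auto

lemma real_value_restrict: "X \<subseteq> S \<Longrightarrow> real_value (sm_restrict z S) X = real_value z X"
  unfolding real_value_def sm_restrict_def by simp

lemma submodular_restrict:
  assumes "submodular I z" "S \<subseteq> I" "z S < \<infinity>"
  shows "submodular S (sm_restrict z S)"
proof -
  have "sm_restrict z S A = z A" if "A \<subseteq> S" for A
    using that unfolding sm_restrict_def by simp
  moreover have "A \<union> B \<subseteq> S" "A \<inter> B \<subseteq> S" "A \<subseteq> I" if "A \<subseteq> S" "B \<subseteq> S" for A B
    using that assms(2) by blast+
  ultimately show ?thesis
    using assms unfolding submodular_def by simp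
qed

context
  fixes I S :: "'a set" and z :: "'a set \<Rightarrow> ereal"
  assumes sm: "submodular I z" and S: "S \<in> finite_valued I z"
begin

lemma sm_contract_finite:
  assumes "U \<subseteq> I - S" "S \<union> U \<in> finite_valued I z"
  shows "sm_contract I z S U = ereal (real_value z (S \<union> U) - real_value z S)"
  using assms ereal_real_value[OF sm S] ereal_real_value[OF sm assms(2)] unfolding sm_contract_def by simp

lemma sm_contract_infinite:
  assumes "U \<subseteq> I - S" "S \<union> U \<notin> finite_valued I z"
  shows "sm_contract I z S U = \<infinity>"
proof -
  have "S \<union> U \<subseteq> I" using assms S unfolding finite_valued_def by auto
  then show ?thesis
    using assms ereal_real_value[OF sm S] infinite_value[OF _ assms(2)] unfolding sm_contract_def by simp
qed

lemma finite_valued_contract: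
  "finite_valued (I - S) (sm_contract I z S) = contract_family (finite_valued I z) S"
proof (intro set_eqI iffI)
  fix U assume "U \<in> finite_valued (I - S) (sm_contract I z S)"
  then have "U \<subseteq> I - S" "sm_contract I z S U < \<infinity>" unfolding finite_valued_def by auto
  then show "U \<in> contract_family (finite_valued I z) S"
    using sm_contract_infinite[of U] unfolding contract_family_def by auto
next
  fix U assume "U \<in> contract_family (finite_valued I z) S"
  then have "U \<subseteq> I - S" "S \<union> U \<in> finite_valued I z"
    unfolding contract_family_def finite_valued_def by auto
  then show "U \<in> finite_valued (I - S) (sm_contract I z S)"
    using sm_contract_finite[of U] unfolding finite_valued_def by auto
qed

lemma real_value_contract:
  assumes "U \<in> contract_family (finite_valued I z) S"
  shows "real_value (sm_contract I z S) U = real_value z (S \<union> U) - real_value z S"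
proof -
  have "U \<subseteq> I - S" "S \<union> U \<in> finite_valued I z"
    using assms unfolding contract_family_def finite_valued_def by auto
  then show ?thesis using sm_contract_finite unfolding real_value_def[of "sm_contract I z S"] by simp
qed

lemma submodular_contract: "submodular (I - S) (sm_contract I z S)"
proof -
  let ?c = "sm_contract I z S" and ?F = "finite_valued I z"
  note s = submodular_onD[OF submodular_on_finite_valued[OF sm]]
  have ni: "?c A \<noteq> -\<infinity>" if "A \<subseteq> I - S" for A
    using sm_contract_finite[OF that] sm_contract_infinite[OF that] by (cases "S \<union> A \<in> ?F") auto
  have SI: "S \<subseteq> I" using S unfolding finite_valued_def by auto
  have le: "?c (A \<union> B) + ?c (A \<inter> B) \<le> ?c A + ?c B" if AB: "A \<subseteq> I - S" "B \<subseteq> I - S" for A B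
  proof (cases "S \<union> A \<in> ?F \<and> S \<union> B \<in> ?F")
    case True
    have e: "(S \<union> A) \<union> (S \<union> B) = S \<union> (A \<union> B)" "(S \<union> A) \<inter> (S \<union> B) = S \<union> (A \<inter> B)" by blast+
    have sub: "A \<union> B \<subseteq> I - S" "A \<inter> B \<subseteq> I - S" using AB by auto
    have f: "S \<union> (A \<union> B) \<in> ?F" "S \<union> (A \<inter> B) \<in> ?F"
      and l: "real_value z (S \<union> (A \<union> B)) + real_value z (S \<union> (A \<inter> B)) \<le> real_value z (S \<union> A) + real_value z (S \<union> B)"
      using s[of "S \<union> A" "S \<union> B"] True unfolding e by auto
    then show ?thesis
      using True AB sub by (simp add: sm_contract_finite)
  next
    case False
    then have "?c A + ?c B = \<infinity>"
      using sm_contract_infinite AB by auto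
    then show ?thesis by (simp only: ereal_less_eq(1))
  qed
  have "?c {} = 0" using sm_contract_finite[of "{}"] S by simp
  moreover have "S \<union> (I - S) = I" using SI by blast
  then have "?c (I - S) < \<infinity>"
    using sm_contract_finite[of "I - S"] ground_set_finite_valued[OF sm] by simp
  ultimately show ?thesis using ni le unfolding submodular_def by blast
qed

end

lemma conforming_family_cong:
  assumes "\<And>X. X \<in> \<F> \<Longrightarrow> r X = r' X" "\<And>X Y. X \<in> \<F> \<Longrightarrow> Y \<in> \<F> \<Longrightarrow> X \<union> Y \<in> \<F> \<and> X \<inter> Y \<in> \<F>"
  shows "conforming_family \<F> r D \<longleftrightarrow> conforming_family \<F> r' D"
proof -
  have imp: "conforming_family \<F> s' D"
    if c: "conforming_family \<F> s D" and eq: "\<And>X. X \<in> \<F> \<Longrightarrow> s X = s' X" for s s'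
  proof -
    have "s' (X \<union> Y) + s' (X \<inter> Y) = s' X + s' Y \<longleftrightarrow> s (X \<union> Y) + s (X \<inter> Y) = s X + s Y"
      if "X \<in> \<F>" "Y \<in> \<F>" for X Y
      using that assms(2) eq by metis
    then show ?thesis
      using conforming_familyD[OF c] by (intro conforming_familyI) blast+
  qed
  show ?thesis using imp assms(1) by metis
qed

lemma conforms_restrict_iff:
  assumes sm: "submodular I z" and S: "S \<in> finite_valued I z"
  shows "conforms S (sm_restrict z S) P \<longleftrightarrow>
    preorder_on S P \<and> conforming_family (restrict_family (finite_valued I z) S) (real_value z) (down_sets S P)"
proof -
  have SI: "S \<subseteq> I" "z S < \<infinity>" using S unfolding finite_valued_def by auto
  note sm1 = submodular_restrict[OF sm SI]
  have "conforming_family (restrict_family (finite_valued I z) S) (real_value (sm_restrict z S)) (down_sets S P)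
    \<longleftrightarrow> conforming_family (restrict_family (finite_valued I z) S) (real_value z) (down_sets S P)"
    by (rule conforming_family_cong)
      (use submodular_onD[OF submodular_on_finite_valued[OF sm]] in
        \<open>auto simp: restrict_family_def real_value_restrict\<close>)
  then show ?thesis
    using conforms_iff[OF sm1] finite_valued_restrict[OF SI(1)] by metis
qed

lemma conforms_contract_iff:
  assumes sm: "submodular I z" and S: "S \<in> finite_valued I z"
  shows "conforms (I - S) (sm_contract I z S) P \<longleftrightarrow> preorder_on (I - S) P \<and>
    conforming_family (contract_family (finite_valued I z) S) (\<lambda>U. real_value z (S \<union> U) - real_value z S)
      (down_sets (I - S) P)"
proof -
  note sm2 = submodular_contract[OF sm S]
  have "conforming_family (contract_family (finite_valued I z) S) (real_value (sm_contract I z S)) (down_sets (I - S) P)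
    \<longleftrightarrow> conforming_family (contract_family (finite_valued I z) S) (\<lambda>U. real_value z (S \<union> U) - real_value z S)
      (down_sets (I - S) P)"
    by (rule conforming_family_cong)
      (use real_value_contract[OF sm S] submodular_onD[OF submodular_on_finite_valued[OF sm2]]
         finite_valued_contract[OF sm S] in auto)
  then show ?thesis
    using conforms_iff[OF sm2] finite_valued_contract[OF sm S] by metis
qed

section \<open>The bijection\<close>

text \<open>
  Injectivity is the recovery of a conforming family from its parts.  For surjectivity the preorder
  is read off from the glued family, whose two parts are the given ones.
\<close>

lemma bij_betw_conforming_parts:
  assumes fin: "finite I" and sm: "submodular I z" and S: "S \<in> finite_valued I z"
  shows "bij_betw (\<lambda>P. (Restr P S, Restr P (I - S)))
    {P. conforms I z P \<and> down_set I P S}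
    ({P1. conforms S (sm_restrict z S) P1} \<times> {P2. conforms (I - S) (sm_contract I z S) P2})"
    (is "bij_betw ?f ?A ?B")
  unfolding bij_betw_def
proof
  let ?F = "finite_valued I z" and ?r = "real_value z" and ?T = "I - S"
  let ?rT = "\<lambda>U. ?r (S \<union> U) - ?r S"
  have SI: "S \<subseteq> I" using S unfolding finite_valued_def by auto
  note parts = down_sets_Restr_down_set down_sets_Restr_complement
  have memA: "preorder_on I P" "conforming_family ?F ?r (down_sets I P)" "S \<in> down_sets I P"
    if "P \<in> ?A" for P
    using that conforms_iff[OF sm] unfolding down_sets_def by auto
  show "inj_on ?f ?A"
  proof (rule inj_onI)
    fix P Q assume P: "P \<in> ?A" and Q: "Q \<in> ?A" and eq: "?f P = ?f Q"
    have rebuild: "down_sets I P = glue_families ?F ?r S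
        (down_sets S (Restr P S)) (down_sets ?T (Restr P ?T))" if "P \<in> ?A" for P
      using glue_families_of_parts[OF memA(2,3)[OF that] down_sets_Un down_sets_Int]
        parts(1)[OF memA(3)[OF that]] parts(2)[OF memA(1,3)[OF that]] by simp
    have "down_sets I P = down_sets I Q"
      using rebuild[OF P] rebuild[OF Q] eq by simp
    then show "P = Q"
      by (rule down_sets_inject[OF memA(1)[OF P] memA(1)[OF Q]])
  qed
  show "?f ` ?A = ?B"
  proof
    show "?f ` ?A \<subseteq> ?B"
    proof (rule image_subsetI)
      fix P assume P: "P \<in> ?A"
      note m = memA[OF P]
      show "?f P \<in> ?B"
        using conforming_family_restrict[OF m(2), of S] conforming_family_contract[OF m(2), of S]
          parts(1)[OF m(3)] parts(2)[OF m(1,3)]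
          preorder_on_Restr[OF m(1) SI] preorder_on_Restr[OF m(1) Diff_subset]
          conforms_restrict_iff[OF sm S] conforms_contract_iff[OF sm S]
        by simp
    qed
    show "?B \<subseteq> ?f ` ?A"
    proof
      fix PP assume "PP \<in> ?B"
      then obtain P1 P2 where PP: "PP = (P1, P2)"
        and c: "conforms S (sm_restrict z S) P1" "conforms ?T (sm_contract I z S) P2"
        by auto
      let ?D1 = "down_sets S P1" and ?D2 = "down_sets ?T P2"
      have pre: "preorder_on S P1" "preorder_on ?T P2"
        and D1: "conforming_family (restrict_family ?F S) ?r ?D1"
        and D2: "conforming_family (contract_family ?F S) ?rT ?D2"
        using c conforms_restrict_iff[OF sm S] conforms_contract_iff[OF sm S] by auto
      define D where "D = glue_families ?F ?r S ?D1 ?D2"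
      note sub = submodular_on_finite_valued[OF sm]
      note lattice = glue_families_lattice[OF sub S D1 D2
          down_sets_Un down_sets_Int down_sets_Un down_sets_Int, folded D_def]
      note restr = restrict_glue_families[OF sub S D1 D2, OF trivial_down_sets(1)[OF pre(2)], folded D_def]
      note contr = contract_glue_families[OF sub S D1 D2, OF trivial_down_sets(2)[OF pre(1)], folded D_def]
      have "D \<subseteq> Pow I" unfolding D_def glue_families_def finite_valued_def by auto
      moreover have "{} \<in> D"
        using restr trivial_down_sets(1)[OF pre(1)] unfolding restrict_family_def by auto
      moreover have SD: "S \<in> D"
        using restr trivial_down_sets(2)[OF pre(1)] unfolding restrict_family_def by auto
      moreover have "I \<in> D"
      proof -
        have "?T \<in> contract_family D S" using contr trivial_down_sets(2)[OF pre(2)] by simp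
        moreover have "S \<union> ?T = I" using SI by blast
        ultimately show ?thesis unfolding contract_family_def by simp
      qed
      ultimately have D: "down_sets I (preorder_of_family I D) = D"
        by (intro down_sets_preorder_of_family[OF fin] lattice(1,2))
      define P where "P = preorder_of_family I D"
      have preP: "preorder_on I P" unfolding P_def by (rule preorder_on_preorder_of_family)
      have DP: "down_sets I P = D" using D unfolding P_def .
      have "conforming_family ?F ?r D"
      proof (rule conforming_familyI)
        show "D \<subseteq> ?F" unfolding D_def glue_families_def by auto
      qed (rule lattice(3) glue_families_factor[OF sub S D1 D2, folded D_def]; assumption)+
      then have "P \<in> ?A"
        using preP DP SD conforms_iff[OF sm] down_sets_def[of I P] by auto
      moreover have "Restr P S = P1"
        using down_sets_inject[OF preorder_on_Restr[OF preP SI] pre(1)]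
          parts(1)[of S I P] SD DP restr by simp
      moreover have "Restr P ?T = P2"
        using down_sets_inject[OF preorder_on_Restr[OF preP Diff_subset] pre(2)]
          parts(2)[OF preP, of S] SD DP contr by simp
      ultimately show "PP \<in> ?f ` ?A" using PP by blast
    qed
  qed
qed

section \<open>Faces as products\<close>

text \<open>
  The equation \<open>x\<^sub>I = z(I)\<close> of the polyhedron is absorbed into the equations of the face,
  because \<open>I\<close> is a down-set.
\<close>

lemma mem_face_of_preorder_iff:
  assumes sm: "submodular I z" and P: "preorder_on I P" and D: "down_sets I P \<subseteq> finite_valued I z"
  shows "x \<in> face_of_preorder I z P \<longleftrightarrow> x \<in> vec_space I \<and>
    (\<forall>A\<in>finite_valued I z. sum x A \<le> real_value z A) \<and> (\<forall>A\<in>down_sets I P. sum x A = real_value z A)"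
proof -
  note ev = ereal_real_value[OF sm]
  have le: "(\<forall>A\<subseteq>I. z A < \<infinity> \<longrightarrow> ereal (sum x A) \<le> z A) \<longleftrightarrow>
      (\<forall>A\<in>finite_valued I z. sum x A \<le> real_value z A)"
  proof -
    have "(\<forall>A\<subseteq>I. z A < \<infinity> \<longrightarrow> ereal (sum x A) \<le> z A) \<longleftrightarrow>
      (\<forall>A\<in>finite_valued I z. ereal (sum x A) \<le> z A)" unfolding finite_valued_def by blast
    then show ?thesis using ev by auto
  qed
  have eq: "(\<forall>A. down_set I P A \<longrightarrow> ereal (sum x A) = z A) \<longleftrightarrow>
      (\<forall>A\<in>down_sets I P. sum x A = real_value z A)"
  proof -
    have "(\<forall>A. down_set I P A \<longrightarrow> ereal (sum x A) = z A) \<longleftrightarrow>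
      (\<forall>A\<in>down_sets I P. ereal (sum x A) = z A)" unfolding down_sets_def by blast
    then show ?thesis using ev D by (auto simp: subset_iff)
  qed
  have "ereal (sum x I) = z I" if "\<forall>A. down_set I P A \<longrightarrow> ereal (sum x A) = z A"
    using that trivial_down_sets(2)[OF P] unfolding down_sets_def by blast
  then show ?thesis
    unfolding face_of_preorder_def polyhedron_of_def using le eq by blast
qed

lemma face_of_preorder_eq_vec_prod:
  assumes fin: "finite I" and sm: "submodular I z" and S: "S \<in> finite_valued I z"
    and c: "conforms I z P" and SP: "S \<in> down_sets I P"
  shows "face_of_preorder I z P =
    vec_prod (face_of_preorder S (sm_restrict z S) (Restr P S))
      (face_of_preorder (I - S) (sm_contract I z S) (Restr P (I - S)))"
    (is "?\<Phi> = vec_prod ?\<Phi>S ?\<Phi>T")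
proof -
  let ?F = "finite_valued I z" and ?r = "real_value z" and ?T = "I - S"
  have SI: "S \<subseteq> I" "z S < \<infinity>" using S unfolding finite_valued_def by auto
  note sub = submodular_onD[OF submodular_on_finite_valued[OF sm]]
  have pre: "preorder_on I P" and fam: "conforming_family ?F ?r (down_sets I P)"
    using c conforms_iff[OF sm] by auto
  then have DF: "down_sets I P \<subseteq> ?F" unfolding conforming_family_def by auto
  have dS: "down_sets S (Restr P S) = restrict_family (down_sets I P) S"
    by (rule down_sets_Restr_down_set[OF SP])
  have dT: "down_sets ?T (Restr P ?T) = contract_family (down_sets I P) S"
    by (rule down_sets_Restr_complement[OF pre SP])
  note fS = finite_valued_restrict[OF SI(1), of z] and fT = finite_valued_contract[OF sm S]
  have memS: "x \<in> ?\<Phi>S \<longleftrightarrow> x \<in> vec_space S \<and> (\<forall>A\<in>restrict_family ?F S. sum x A \<le> ?r A) \<and>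
      (\<forall>A\<in>restrict_family (down_sets I P) S. sum x A = ?r A)" for x
  proof -
    have "restrict_family (down_sets I P) S \<subseteq> restrict_family ?F S"
      using DF unfolding restrict_family_def by auto
    then show ?thesis
      using mem_face_of_preorder_iff[OF submodular_restrict[OF sm SI] preorder_on_Restr[OF pre SI(1)], of x]
      unfolding dS fS by (simp add: restrict_family_def real_value_restrict)
  qed
  have memT: "x \<in> ?\<Phi>T \<longleftrightarrow> x \<in> vec_space ?T \<and>
      (\<forall>U\<in>contract_family ?F S. sum x U \<le> ?r (S \<union> U) - ?r S) \<and>
      (\<forall>U\<in>contract_family (down_sets I P) S. sum x U = ?r (S \<union> U) - ?r S)" for x
  proof -
    have "contract_family (down_sets I P) S \<subseteq> contract_family ?F S"
      using DF unfolding contract_family_def by auto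
    then show ?thesis
      using mem_face_of_preorder_iff[OF submodular_contract[OF sm S]
          preorder_on_Restr[OF pre Diff_subset], of x]
      unfolding dT fT by (simp add: real_value_contract[OF sm S] subset_iff)
  qed
  note mem = mem_face_of_preorder_iff[OF sm pre DF]
  show ?thesis
  proof
    show "?\<Phi> \<subseteq> vec_prod ?\<Phi>S ?\<Phi>T"
    proof
      fix x assume "x \<in> ?\<Phi>"
      then have x: "x \<in> vec_space I" "\<And>A. A \<in> ?F \<Longrightarrow> sum x A \<le> ?r A"
        "\<And>A. A \<in> down_sets I P \<Longrightarrow> sum x A = ?r A" using mem by auto
      define u v where "u = (\<lambda>i. if i \<in> S then x i else 0)" and "v = (\<lambda>i. if i \<in> S then 0 else x i)"
      have u: "sum u A = sum x A" if "A \<subseteq> S" for A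
        unfolding u_def using that by (intro sum.cong) auto
      have v: "sum v U = sum x (S \<union> U) - ?r S" if "U \<inter> S = {}" "S \<union> U \<in> ?F" for U
      proof -
        have "finite U" "finite S" using that(2) fin finite_subset unfolding finite_valued_def by auto
        then have "sum x (S \<union> U) = sum x S + sum x U"
          using that(1) by (intro sum.union_disjoint) auto
        moreover have "sum v U = sum x U" unfolding v_def using that by (intro sum.cong) auto
        ultimately show ?thesis using x(3)[OF SP] by simp
      qed
      have "u \<in> ?\<Phi>S"
        unfolding memS using x(2,3) u by (auto simp: vec_space_def u_def restrict_family_def)
      moreover have "v \<in> ?\<Phi>T"
        unfolding memT using x v DF by (auto simp: vec_space_def v_def contract_family_def subset_iff)
      moreover have "x = (\<lambda>i. u i + v i)" unfolding u_def v_def by auto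
      ultimately show "x \<in> vec_prod ?\<Phi>S ?\<Phi>T" unfolding vec_prod_def by force
    qed
    \<comment> \<open>The parts of \<open>A\<close> below and above \<open>S\<close> bound \<open>x\<^sub>A\<close> by \<open>z(A \<inter> S) + z(A \<union> S) - z(S)\<close>, which
      submodularity bounds by \<open>z(A)\<close> and which modularity identifies with \<open>z(A)\<close> on down-sets.\<close>
    show "vec_prod ?\<Phi>S ?\<Phi>T \<subseteq> ?\<Phi>"
    proof
      fix x assume "x \<in> vec_prod ?\<Phi>S ?\<Phi>T"
      then obtain u v where xuv: "x = (\<lambda>i. u i + v i)" and "u \<in> ?\<Phi>S" "v \<in> ?\<Phi>T"
        unfolding vec_prod_def by auto
      then have u: "u \<in> vec_space S" "\<And>A. A \<in> restrict_family ?F S \<Longrightarrow> sum u A \<le> ?r A"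
          "\<And>A. A \<in> restrict_family (down_sets I P) S \<Longrightarrow> sum u A = ?r A"
        and v: "v \<in> vec_space ?T"
          "\<And>U. U \<in> contract_family ?F S \<Longrightarrow> sum v U \<le> ?r (S \<union> U) - ?r S"
          "\<And>U. U \<in> contract_family (down_sets I P) S \<Longrightarrow> sum v U = ?r (S \<union> U) - ?r S"
        using memS memT by auto
      have split: "sum x A = sum u (A \<inter> S) + sum v (A - S)" if "A \<subseteq> I" for A
      proof -
        have fA: "finite A" using that fin finite_subset by auto
        have "sum u A = sum u (A \<inter> S)"
          using fA u(1) by (intro sum.mono_neutral_right) (auto simp: vec_space_def)
        moreover have "sum v A = sum v (A - S)"
          using fA v(1) by (intro sum.mono_neutral_right) (auto simp: vec_space_def)
        ultimately show ?thesis unfolding xuv by (simp add: sum.distrib)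
      qed
      have AS: "S \<union> (A - S) = A \<union> S" for A by blast
      have pieces: "A \<inter> S \<in> restrict_family F S" "A - S \<in> contract_family F S"
        if "A \<inter> S \<in> F" "A \<union> S \<in> F" for A F
        using that AS unfolding restrict_family_def contract_family_def by auto
      have "sum x A \<le> ?r A" if A: "A \<in> ?F" for A
      proof -
        note s = sub[OF A S]
        have "sum u (A \<inter> S) \<le> ?r (A \<inter> S)" "sum v (A - S) \<le> ?r (A \<union> S) - ?r S"
          using u(2)[OF pieces(1)[OF s(2,1)]] v(2)[OF pieces(2)[OF s(2,1)]] unfolding AS by auto
        moreover have "A \<subseteq> I" using A unfolding finite_valued_def by auto
        ultimately show ?thesis using split[of A] s(3) by linarith
      qed
      moreover have "sum x A = ?r A" if A: "A \<in> down_sets I P" for A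
      proof -
        note d = down_sets_Int[OF A SP] down_sets_Un[OF A SP]
        have "sum u (A \<inter> S) = ?r (A \<inter> S)" "sum v (A - S) = ?r (A \<union> S) - ?r S"
          using u(3)[OF pieces(1)[OF d]] v(3)[OF pieces(2)[OF d]] unfolding AS by auto
        moreover have "?r (A \<union> S) + ?r (A \<inter> S) = ?r A + ?r S"
          by (rule conforming_familyD(2)[OF fam A SP])
        moreover have "A \<subseteq> I" using A unfolding down_sets_def down_set_def by auto
        ultimately show ?thesis using split[of A] by linarith
      qed
      moreover have "x \<in> vec_space I"
        using u(1) v(1) SI(1) unfolding xuv vec_space_def by auto
      ultimately show "x \<in> ?\<Phi>" unfolding mem by blast
    qed
  qed
qed

theorem proposition11p1:
  fixes I S T :: "'a set" and z :: "'a set \<Rightarrow> ereal"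
  assumes "finite I" and "submodular I z"
    and "S \<subseteq> I" and "z S < \<infinity>" and "T = I - S"
  shows "bij_betw (\<lambda>P. (Restr P S, Restr P T))
           {P. conforms I z P \<and> down_set I P S}
           ({P1. conforms S (sm_restrict z S) P1} \<times> {P2. conforms T (sm_contract I z S) P2})
       \<and> (\<forall>P P1 P2 F F\<^sub>S G\<^sub>T.
            conforms I z P \<and> down_set I P S \<and> P1 = Restr P S \<and> P2 = Restr P T \<and>
            F = face_of_preorder I z P \<and>
            F\<^sub>S = face_of_preorder S (sm_restrict z S) P1 \<and>
            G\<^sub>T = face_of_preorder T (sm_contract I z S) P2 \<longrightarrow>
            F = vec_prod F\<^sub>S G\<^sub>T)"
proof -
  have S: "S \<in> finite_valued I z" using assms(3,4) unfolding finite_valued_def by simp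
  show ?thesis
    using bij_betw_conforming_parts[OF assms(1,2) S]
      face_of_preorder_eq_vec_prod[OF assms(1,2) S]
    unfolding assms(5) down_sets_def by blast
qed

end
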